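(* There exists an interval exchange map $T$ of $d=4$ intervals, with admissible combinatorial data, with the Keane property and with total length $\lambda^*=1$, such that (Z) for every $\varepsilon>0$ there is $C_\varepsilon>0$ such that $\|Z(k,k+1)\|\le C_\varepsilon\|Z(k)\|^{\varepsilon}$ for all $k\ge1$, but $T$ does not satisfy the condition (U) $\lim_{r\to0^+}\frac{\log\tau_r(x)}{-\log r}=1$ uniformly in $x\in[0,1)$.
   Context: Interval exchange maps. Let $\mathcal A$ be an alphabet with $d$ letters. Combinatorial data is a pair $\pi=(\pi_t,\pi_b)$ of bijections $\mathcal A\to\{1,\dots,d\}$; it is admissible if $\pi_t^{-1}(\{1,\dots,k\})\ne\pi_b^{-1}(\{1,\dots,k\})$ for $k=1,\dots,d-1$. Length data is a vector $(\lambda_\alpha)_{\alpha\in\mathcal A}$ of positive reals; $\lambda^*=\sum_\alpha\lambda_\alpha$, $I=[0,\lambda^* )$, $p_\alpha=\sum_{\pi_t(\beta)<\pi_t(\alpha)}\lambda_\beta$, $I_\alpha=[p_\alpha,p_\alpha+\lambda_\alpha)$. The map is $T(x)=x+\sum_{\pi_b(\beta)<\pi_b(\alpha)}\lambda_\beta-\sum_{\pi_t(\beta)<\pi_t(\alpha)}\lambda_\beta$ for $x\in I_\alpha$. Keane property: there are no $\alpha,\beta\in\mathcal A$ and $m\ge1$ with $T^m(p_\alpha)=p_\beta$ and $\pi_t(\beta)>1$. Return time. $\tau_r(x)=\min\{j\ge1:\ |T^jx-x|<r\}$ for $r>0$, $x\in I$. Rauzy–Veech algorithm. Let $\alpha_t,\alpha_b$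 be the letters with $\pi_t(\alpha_t)=\pi_b(\alpha_b)=d$. If $\lambda_{\alpha_t}>\lambda_{\alpha_b}$ (top type) the winner is $\alpha_t$ and the loser $\alpha_b$; the new data keep $\pi_t$, and in the order given by $\pi_b$ the letter $\alpha_b$ is moved to the position immediately after $\alpha_t$. If $\lambda_{\alpha_b}>\lambda_{\alpha_t}$ (bottom type) the winner is $\alpha_b$ and the loser $\alpha_t$; the new data keep $\pi_b$, and in the order given by $\pi_t$ the letter $\alpha_t$ is moved to the position immediately after $\alpha_b$. In both cases the winner's length is replaced by (winner's length minus loser's length) and all other lengths are kept. The new map $\mathcal V(T)$ is the first return map of $T$ to $[0,\sum_\alpha\hat\lambda_\alpha)$, where $\hat\lambda$ is the new length vector. For $T$ admissible with the Keane property this can be iterated forever; $T(n)=\mathcal V^n(T)$. Write $\gamma(m,n)$ for the sequence of steps (arrows) from $T(m)$ to $T(n)$. For a step with winner $\alpha$ and loser $\beta$ put $B=\mathbb I+E_{\beta\alpha}$ ($E_{\beta\alpha}$ has its only nonzero entry, a $1$, in row $\beta$, column $\alpha$); $Q(m,n)$ is the product of the matrices of the steps of $\gamma(m,n)$, later steps on the left. The norm $\|\cdot\|$ of a matrix is the sum of the absolute values of its entries. Zorich acceleration. $n_0=0$ and $n_{k+1}>n_k$ is the largest integer such that all steps in $\gamma(n_k,n_{k+1})$ have the same winner. $Z(k)=Q(0,n_k)$, $Z(k,\ell)=Q(n_k,n_\ell)$. *)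

theory Defs
  imports "HOL-Analysis.Analysis"
begin

text \<open>The alphabet is a finite type \<^typ>\<open>'a\<close>, so the number of intervals is \<open>CARD('a)\<close>.\<close>

record 'a iet =
  top_pos :: "'a \<Rightarrow> nat"
  bot_pos :: "'a \<Rightarrow> nat"
  len :: "'a \<Rightarrow> real"

definition iet_data :: "'a::finite iet \<Rightarrow> bool" where
  "iet_data T \<longleftrightarrow>
     bij_betw (top_pos T) UNIV {1..CARD('a)} \<and>
     bij_betw (bot_pos T) UNIV {1..CARD('a)} \<and>
     (\<forall>a. len T a > 0)"

definition admissible :: "'a::finite iet \<Rightarrow> bool" where
  "admissible T \<longleftrightarrow>
     (\<forall>k. 1 \<le> k \<and> k \<le> CARD('a) - 1 \<longrightarrow> top_pos T -` {1..k} \<noteq> bot_pos T -` {1..k})"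

definition total_length :: "'a::finite iet \<Rightarrow> real" where
  "total_length T = (\<Sum>a\<in>UNIV. len T a)"

definition top_left :: "'a::finite iet \<Rightarrow> 'a \<Rightarrow> real" where
  "top_left T a = (\<Sum>b | top_pos T b < top_pos T a. len T b)"

definition bot_left :: "'a::finite iet \<Rightarrow> 'a \<Rightarrow> real" where
  "bot_left T a = (\<Sum>b | bot_pos T b < bot_pos T a. len T b)"

definition iet_interval :: "'a::finite iet \<Rightarrow> 'a \<Rightarrow> real set" where
  "iet_interval T a = {top_left T a ..< top_left T a + len T a}"

text \<open>Only the values on \<open>{0..<total_length T}\<close> are meaningful; this set is invariant.\<close>

definition iet_map :: "'a::finite iet \<Rightarrow> real \<Rightarrow> real" where
  "iet_map T x = (let a = (THE a. x \<in> iet_interval T a) in x + bot_left T a - top_left T a)"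

definition keane :: "'a::finite iet \<Rightarrow> bool" where
  "keane T \<longleftrightarrow>
     \<not> (\<exists>a b. \<exists>m\<ge>1. (iet_map T ^^ m) (top_left T a) = top_left T b \<and> top_pos T b > 1)"

definition return_time :: "'a::finite iet \<Rightarrow> real \<Rightarrow> real \<Rightarrow> nat" where
  "return_time T r x = (LEAST j. j \<ge> 1 \<and> \<bar>(iet_map T ^^ j) x - x\<bar> < r)"

definition last_top :: "'a::finite iet \<Rightarrow> 'a" where
  "last_top T = (THE a. top_pos T a = CARD('a))"

definition last_bot :: "'a::finite iet \<Rightarrow> 'a" where
  "last_bot T = (THE a. bot_pos T a = CARD('a))"

text \<open>In case of a tie between the two last letters the algorithm stops, and \<open>winner\<close>, \<open>loser\<close>
  and \<open>rauzy_veech\<close> have irrelevant values; this never occurs in the orbit of admissible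
  data with the Keane property.\<close>

definition winner :: "'a::finite iet \<Rightarrow> 'a" where
  "winner T = (if len T (last_top T) > len T (last_bot T) then last_top T else last_bot T)"

definition loser :: "'a::finite iet \<Rightarrow> 'a" where
  "loser T = (if len T (last_top T) > len T (last_bot T) then last_bot T else last_top T)"

text \<open>\<open>move_after p l w\<close> are the positions obtained from \<open>p\<close> by moving the last letter \<open>l\<close>
  immediately after the letter \<open>w\<close>.\<close>

definition move_after :: "('a \<Rightarrow> nat) \<Rightarrow> 'a \<Rightarrow> 'a \<Rightarrow> 'a \<Rightarrow> nat" where
  "move_after p l w a =
     (if a = l then p w + 1 else if p a \<le> p w then p a else p a + 1)"

definition rauzy_veech :: "'a::finite iet \<Rightarrow> 'a iet" where
  "rauzy_veech T =
     (let w = winner T; l = loser T; new_len = (len T)(w := len T w - len T l) in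
      if len T (last_top T) > len T (last_bot T)
      then \<lparr>top_pos = top_pos T, bot_pos = move_after (bot_pos T) l w, len = new_len\<rparr>
      else \<lparr>top_pos = move_after (top_pos T) l w, bot_pos = bot_pos T, len = new_len\<rparr>)"

definition rv_iter :: "'a::finite iet \<Rightarrow> nat \<Rightarrow> 'a iet" where
  "rv_iter T n = (rauzy_veech ^^ n) T"

definition step_matrix :: "'a::finite iet \<Rightarrow> real^'a^'a" where
  "step_matrix T =
     mat 1 + (\<chi> i j. if i = loser T \<and> j = winner T then 1 else 0)"

primrec rv_matrix :: "'a::finite iet \<Rightarrow> nat \<Rightarrow> nat \<Rightarrow> real^'a^'a" where
  "rv_matrix T m 0 = mat 1"
| "rv_matrix T m (Suc n) =
     (if m \<le> n then step_matrix (rv_iter T n) ** rv_matrix T m n else mat 1)"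

definition matrix_norm1 :: "real^'a^'a \<Rightarrow> real" where
  "matrix_norm1 A = (\<Sum>i\<in>UNIV. \<Sum>j\<in>UNIV. \<bar>A $ i $ j\<bar>)"

text \<open>The step number \<open>i\<close> leads from \<open>rv_iter T i\<close> to \<open>rv_iter T (i + 1)\<close>.\<close>

primrec zorich_time :: "'a::finite iet \<Rightarrow> nat \<Rightarrow> nat" where
  "zorich_time T 0 = 0"
| "zorich_time T (Suc k) =
     (GREATEST n. n > zorich_time T k \<and>
        (\<exists>w. \<forall>i\<in>{zorich_time T k..<n}. winner (rv_iter T i) = w))"

definition zorich_matrix :: "'a::finite iet \<Rightarrow> nat \<Rightarrow> nat \<Rightarrow> real^'a^'a" where
  "zorich_matrix T k l = rv_matrix T (zorich_time T k) (zorich_time T l)"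

definition condition_Z :: "'a::finite iet \<Rightarrow> bool" where
  "condition_Z T \<longleftrightarrow>
     (\<forall>\<epsilon>>0. \<exists>C>0. \<forall>k\<ge>1.
        matrix_norm1 (zorich_matrix T k (k + 1)) \<le> C * matrix_norm1 (zorich_matrix T 0 k) powr \<epsilon>)"

definition condition_U :: "'a::finite iet \<Rightarrow> bool" where
  "condition_U T \<longleftrightarrow>
     uniform_limit {0..<total_length T}
       (\<lambda>r x. ln (real (return_time T r x)) / (- ln r)) (\<lambda>x. 1) (at_right 0)"

end

theory Submission
  imports Defs
begin

text \<open>The construction prescribes an infinite Rauzy path whose winners change within a bounded number
  of steps, so that all Zorich matrices are bounded and (Z) is trivial. The path alternates between a
  loop with positive matrix and long runs of a loop that never involves the letter \<open>A\<close>. During such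
  a run the tower over \<open>I\<^sub>A\<close> keeps its height \<open>h\<close>, while the other towers grow and the
  induction interval shrinks; if the run is long enough, the interval gets shorter than \<open>h\<^sup>-\<^sup>2\<close>.
  The points of \<open>I\<^sub>A\<close> come back to this interval after \<open>h\<close> steps, so their return time at this
  scale is at most the square root of the expected one, which contradicts (U). Keane's property
  holds because a connection would persist along the path while its endpoint is eventually constant,
  although the induction intervals shrink to a point.\<close>

section \<open>Positions and one Rauzy--Veech step\<close>

text \<open>Common form of \<open>top_left\<close> and \<open>bot_left\<close>, so that facts on
  endpoints are proved once for both rows.\<close>

definition left_end :: "('a::finite \<Rightarrow> nat) \<Rightarrow> ('a \<Rightarrow> real) \<Rightarrow> 'a \<Rightarrow> real" where
  "left_end p f a = (\<Sum>b | p b < p a. f b)"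

lemma top_left_eq: "top_left T = left_end (top_pos T) (len T)"
  and bot_left_eq: "bot_left T = left_end (bot_pos T) (len T)"
  by (auto simp: fun_eq_iff top_left_def bot_left_def left_end_def)

section \<open>Left endpoints in one row and their change under a step\<close>

locale positioned_lengths =
  fixes p :: "'a::finite \<Rightarrow> nat" and f :: "'a \<Rightarrow> real"
  assumes bij: "bij_betw p UNIV {1..CARD('a)}"
    and pos: "\<And>a. f a > 0"
begin

lemma inj: "p a = p b \<longleftrightarrow> a = b"
  using bij by (auto simp: bij_betw_def inj_on_def)

lemma range: "1 \<le> p a" "p a \<le> CARD('a)"
  using bij_betwE[OF bij] by auto

lemma left_end_last:
  assumes "p a = CARD('a)"
  shows "left_end p f a = sum f UNIV - f a"
proof -
  have "p b < p a \<longleftrightarrow> b \<noteq> a" for b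
    using assms range(2)[of b] inj[of b a] by auto
  then have "{b. p b < p a} = UNIV - {a}" by auto
  then show ?thesis by (simp add: left_end_def sum_diff1)
qed

lemma left_end_add_le:
  assumes "p a < p b"
  shows "left_end p f a + f a \<le> left_end p f b"
proof -
  have "left_end p f a + f a = sum f (insert a {c. p c < p a})"
    by (simp add: left_end_def)
  also have "\<dots> \<le> left_end p f b"
    unfolding left_end_def using assms by (intro sum_mono2) (auto intro: less_imp_le pos)
  finally show ?thesis .
qed

lemma left_end_Suc:
  assumes "p b = Suc (p a)"
  shows "left_end p f b = left_end p f a + f a"
proof -
  have "{c. p c < p b} = insert a {c. p c < p a}"
    using assms inj by (auto simp: less_Suc_eq)
  then show ?thesis by (simp add: left_end_def)
qed

lemma left_end_nonneg: "0 \<le> left_end p f a"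
  unfolding left_end_def by (intro sum_nonneg) (auto intro: less_imp_le pos)

lemma left_end_add_le_sum: "left_end p f a + f a \<le> sum f UNIV"
proof -
  have "left_end p f a + f a = sum f (insert a {c. p c < p a})"
    by (simp add: left_end_def)
  also have "\<dots> \<le> sum f UNIV"
    by (intro sum_mono2) (auto intro: less_imp_le pos)
  finally show ?thesis .
qed

lemma left_end_pos:
  assumes "p a > 1"
  shows "left_end p f a > 0"
proof -
  have "1 \<in> p ` UNIV"
    using bij assms range(2)[of a] by (auto simp: bij_betw_def)
  then obtain b where "p b = 1" by auto
  then show ?thesis
    using left_end_add_le[of b a] assms left_end_nonneg[of b] pos[of b] by simp
qed

lemma interval_unique:
  assumes "x \<in> {left_end p f a..<left_end p f a + f a}" "x \<in> {left_end p f b..<left_end p f b + f b}"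
  shows "a = b"
proof -
  have "\<not> p a < p b" "\<not> p b < p a"
    using assms left_end_add_le[of a b] left_end_add_le[of b a] by auto
  then show ?thesis using inj[of a b] by simp
qed

text \<open>Take the last letter whose left endpoint is at most \<open>x\<close>: it ends where the
  next letter begins, and that is beyond \<open>x\<close>.\<close>

lemma interval_exists:
  assumes "0 \<le> x" "x < sum f UNIV"
  shows "\<exists>a. x \<in> {left_end p f a..<left_end p f a + f a}"
proof -
  let ?S = "{a. left_end p f a \<le> x}"
  have surj: "\<exists>a. p a = k" if "1 \<le> k" "k \<le> CARD('a)" for k
  proof -
    have "k \<in> p ` UNIV" using bij_betw_imp_surj_on[OF bij] that by simp
    then show ?thesis by auto
  qed
  obtain a0 where a0: "p a0 = 1" using surj[of 1] by auto
  then have "{c. p c < p a0} = {}" using range(1) by (auto simp: Suc_le_eq)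
  then have "left_end p f a0 = 0" by (simp add: left_end_def)
  then have "a0 \<in> ?S" using assms(1) by simp
  then have "?S \<noteq> {}" by blast
  then obtain a where a: "a \<in> ?S" and max: "\<forall>b\<in>?S. p b \<le> p a"
    using finite_has_maximal[of "p ` ?S"] by (force simp: not_le[symmetric])
  have "x < left_end p f a + f a"
  proof (cases "p a = CARD('a)")
    case True
    then show ?thesis using left_end_last assms(2) by simp
  next
    case False
    then obtain b where b: "p b = Suc (p a)" using surj[of "Suc (p a)"] range(2)[of a] by auto
    then have "b \<notin> ?S" using max by auto
    then show ?thesis using left_end_Suc[OF b] by auto
  qed
  then show ?thesis using a by auto
qed

text \<open>No left endpoint in a row counts the length of the last letter of that row.\<close>

lemma left_end_shrink_last:
  assumes "p w = CARD('a)"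
  shows "left_end p (f(w := c)) a = left_end p f a"
  unfolding left_end_def using assms range(2)[of a] by (intro sum.cong) auto

text \<open>A letter to the right of \<open>w\<close> gets \<open>l\<close> in front of it while
  \<open>w\<close> shrinks by the same amount \<open>f l\<close>; the two changes cancel.\<close>

lemma left_end_move_after:
  assumes "p l = CARD('a)" "w \<noteq> l"
  shows "left_end (move_after p l w) (f(w := f w - f l)) a =
    (if a = l then left_end p f w + f w - f l else left_end p f a)"
proof -
  let ?q = "move_after p l w" and ?g = "f(w := f w - f l)"
  have pl: "p b < p l" if "b \<noteq> l" for b
    using assms(1) range(2)[of b] inj[of b l] that by auto
  consider "a = l" | "a \<noteq> l" "p a \<le> p w" | "a \<noteq> l" "p w < p a" by fastforce
  then show ?thesis
  proof cases
    case 1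
    have "?q b < ?q a \<longleftrightarrow> b = w \<or> p b < p w" for b
      using pl[of w] inj[of b w] 1 assms(2) by (auto simp: move_after_def)
    then have "{b. ?q b < ?q a} = insert w {b. p b < p w}" by auto
    moreover have "(\<Sum>b | p b < p w. ?g b) = left_end p f w"
      unfolding left_end_def by (intro sum.cong) auto
    ultimately show ?thesis using 1 by (simp add: left_end_def)
  next
    case 2
    have "{b. ?q b < ?q a} = {b. p b < p a}"
      using assms(2) pl[of w] 2 by (auto simp: move_after_def split: if_splits)
    moreover have "(\<Sum>b | p b < p a. ?g b) = left_end p f a"
      unfolding left_end_def using 2 by (intro sum.cong) auto
    ultimately show ?thesis using 2 by (simp add: left_end_def)
  next
    case 3
    have "{b. ?q b < ?q a} = insert l {b. p b < p a}"
      using assms(2) pl[of w] pl[of a] 3 by (auto simp: move_after_def split: if_splits)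
    moreover have "p l \<ge> p a" using pl[of a] 3 by simp
    ultimately have "left_end ?q ?g a = f l + (\<Sum>b | p b < p a. ?g b)"
      using assms(2) by (simp add: left_end_def)
    also have "(\<Sum>b | p b < p a. ?g b) = (\<Sum>b | p b < p a. f b) - f l"
      using 3 by (subst (1 2) sum.remove[of _ w]) auto
    finally show ?thesis using 3 by (simp add: left_end_def)
  qed
qed

end

lemma iet_data_top: "iet_data T \<Longrightarrow> positioned_lengths (top_pos T) (len T)"
  and iet_data_bot: "iet_data T \<Longrightarrow> positioned_lengths (bot_pos T) (len T)"
  by (auto simp: iet_data_def positioned_lengths_def)

section \<open>The interval exchange map on its base\<close>

context
  fixes T :: "'a::finite iet"
  assumes T: "iet_data T"
begin

interpretation top: positioned_lengths "top_pos T" "len T" by (rule iet_data_top[OF T])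
interpretation bot: positioned_lengths "bot_pos T" "len T" by (rule iet_data_bot[OF T])

lemma iet_map_eq:
  assumes "x \<in> iet_interval T a"
  shows "iet_map T x = x + bot_left T a - top_left T a"
proof -
  have "(THE a. x \<in> iet_interval T a) = a"
    using assms top.interval_unique by (auto simp: iet_interval_def top_left_eq intro!: the_equality)
  then show ?thesis by (simp add: iet_map_def)
qed

lemma ex_iet_interval:
  assumes "x \<in> {0..<total_length T}"
  shows "\<exists>a. x \<in> iet_interval T a"
  using top.interval_exists[of x] assms by (auto simp: iet_interval_def top_left_eq total_length_def)

lemma iet_interval_subset: "iet_interval T a \<subseteq> {0..<total_length T}"
proof
  fix x assume "x \<in> iet_interval T a"
  then show "x \<in> {0..<total_length T}"
    using top.left_end_nonneg[of a] top.left_end_add_le_sum[of a]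
    by (simp add: iet_interval_def top_left_eq total_length_def)
qed

lemma top_left_in_interval: "top_left T a \<in> iet_interval T a"
  using top.pos[of a] by (simp add: iet_interval_def)

lemma iet_map_in_bot:
  assumes "x \<in> iet_interval T a"
  shows "iet_map T x \<in> {bot_left T a..<bot_left T a + len T a}"
  using assms unfolding iet_map_eq[OF assms] by (auto simp: iet_interval_def)

lemma iet_map_in:
  assumes "x \<in> {0..<total_length T}"
  shows "iet_map T x \<in> {0..<total_length T}"
proof -
  obtain a where "x \<in> iet_interval T a" using ex_iet_interval[OF assms] by blast
  then show ?thesis
    using iet_map_in_bot[of x a] bot.left_end_nonneg[of a] bot.left_end_add_le_sum[of a]
    by (auto simp: bot_left_eq total_length_def)
qed

lemma iet_map_funpow_in:
  assumes "x \<in> {0..<total_length T}"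
  shows "(iet_map T ^^ m) x \<in> {0..<total_length T}"
  using assms iet_map_in by (induction m) auto

text \<open>The images of the intervals are the intervals of the bottom row. These are disjoint, so
  the image determines the letter and hence the translation.\<close>

lemma iet_map_inj:
  assumes "x \<in> {0..<total_length T}" "y \<in> {0..<total_length T}" "iet_map T x = iet_map T y"
  shows "x = y"
proof -
  obtain a b where ab: "x \<in> iet_interval T a" "y \<in> iet_interval T b"
    using ex_iet_interval assms by meson
  have "iet_map T x \<in> {bot_left T b..<bot_left T b + len T b}"
    unfolding assms(3) by (rule iet_map_in_bot[OF ab(2)])
  with iet_map_in_bot[OF ab(1)] have "a = b"
    unfolding bot_left_eq by (rule bot.interval_unique)
  then have "y \<in> iet_interval T a" using ab(2) by (simp only:)
  then show ?thesis using iet_map_eq[OF ab(1)] iet_map_eq[of y a] assms(3) by linarith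
qed

end

section \<open>One step as a first return map\<close>

definition rauzy_arrow ::
  "('a::finite \<Rightarrow> nat) \<Rightarrow> ('a \<Rightarrow> nat) \<Rightarrow> 'a \<Rightarrow> 'a \<Rightarrow> ('a \<Rightarrow> nat) \<Rightarrow> ('a \<Rightarrow> nat) \<Rightarrow> bool" where
  "rauzy_arrow pt pb w l pt' pb' \<longleftrightarrow> w \<noteq> l \<and>
    (pt w = CARD('a) \<and> pb l = CARD('a) \<and> pt' = pt \<and> pb' = move_after pb l w \<or>
     pb w = CARD('a) \<and> pt l = CARD('a) \<and> pb' = pb \<and> pt' = move_after pt l w)"

text \<open>An arrow speaks of positions only, so a path can be prescribed before any lengths are
  known. The order of the lengths of \<open>w\<close> and \<open>l\<close> is encoded in the
  positivity of \<open>len T'\<close>.\<close>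

locale rauzy_step =
  fixes T T' :: "'a::finite iet" and w l :: 'a
  assumes data: "iet_data T" "iet_data T'"
    and arrow: "rauzy_arrow (top_pos T) (bot_pos T) w l (top_pos T') (bot_pos T')"
    and len': "len T' = (len T)(w := len T w - len T l)"
begin

sublocale top: positioned_lengths "top_pos T" "len T" by (rule iet_data_top[OF data(1)])
sublocale bot: positioned_lengths "bot_pos T" "len T" by (rule iet_data_bot[OF data(1)])
sublocale top': positioned_lengths "top_pos T'" "len T'" by (rule iet_data_top[OF data(2)])

lemma len_less: "len T l < len T w"
  using top'.pos[of w] by (simp add: len')

lemma neq: "w \<noteq> l"
  using arrow by (simp add: rauzy_arrow_def)

lemma total_length': "total_length T' = total_length T - len T l"
  unfolding total_length_def len' by (subst (1 2) sum.remove[of _ w]) auto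

lemma arrow_cases:
  obtains (top) "top_pos T w = CARD('a)" "bot_pos T l = CARD('a)" "top_pos T' = top_pos T"
      "top_left T w = total_length T - len T w" "bot_left T l = total_length T - len T l"
      "top_left T' = top_left T"
      "\<And>a. bot_left T' a = (if a = l then bot_left T w + len T w - len T l else bot_left T a)"
  | (bottom) "bot_pos T w = CARD('a)" "top_pos T l = CARD('a)"
      "top_pos T' = move_after (top_pos T) l w"
      "bot_left T w = total_length T - len T w" "top_left T l = total_length T - len T l"
      "bot_left T' = bot_left T"
      "\<And>a. top_left T' a = (if a = l then top_left T w + len T w - len T l else top_left T a)"
proof -
  from arrow consider
    "top_pos T w = CARD('a)" "bot_pos T l = CARD('a)"
    "top_pos T' = top_pos T" "bot_pos T' = move_after (bot_pos T) l w" |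
    "bot_pos T w = CARD('a)" "top_pos T l = CARD('a)"
    "bot_pos T' = bot_pos T" "top_pos T' = move_after (top_pos T) l w"
    by (auto simp: rauzy_arrow_def)
  then show thesis
  proof cases
    case 1
    show thesis
    proof (rule that(1)[OF 1(1-3)])
      show "top_left T w = total_length T - len T w" "bot_left T l = total_length T - len T l"
        using top.left_end_last[OF 1(1)] bot.left_end_last[OF 1(2)]
        by (simp_all add: top_left_eq bot_left_eq total_length_def)
      show "top_left T' = top_left T"
        unfolding top_left_eq 1(3) len' using top.left_end_shrink_last[OF 1(1)] by blast
      show "bot_left T' a = (if a = l then bot_left T w + len T w - len T l else bot_left T a)" for a
        unfolding bot_left_eq 1(4) len' by (rule bot.left_end_move_after[OF 1(2) neq])
    qed
  next
    case 2
    show thesis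
    proof (rule that(2)[OF 2(1,2,4)])
      show "bot_left T w = total_length T - len T w" "top_left T l = total_length T - len T l"
        using bot.left_end_last[OF 2(1)] top.left_end_last[OF 2(2)]
        by (simp_all add: top_left_eq bot_left_eq total_length_def)
      show "bot_left T' = bot_left T"
        unfolding bot_left_eq 2(3) len' using bot.left_end_shrink_last[OF 2(1)] by blast
      show "top_left T' a = (if a = l then top_left T w + len T w - len T l else top_left T a)" for a
        unfolding top_left_eq 2(4) len' by (rule top.left_end_move_after[OF 2(2) neq])
    qed
  qed
qed

text \<open>Such an interval keeps its left endpoint and its translation; at most it is cut at its
  right end, if \<open>a = w\<close>.\<close>

lemma iet_interval_nonloser:
  assumes "x \<in> iet_interval T' a" "a \<noteq> l"
  shows "x \<in> iet_interval T a" "iet_map T' x = iet_map T x"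
proof -
  show x: "x \<in> iet_interval T a"
    using assms top.pos[of l]
    by (cases rule: arrow_cases) (auto simp: iet_interval_def len' split: if_splits)
  show "iet_map T' x = iet_map T x"
    unfolding iet_map_eq[OF data(1) x] iet_map_eq[OF data(2) assms(1)]
    using assms(2) by (cases rule: arrow_cases) auto
qed

text \<open>Top type: \<open>T\<close> carries the interval of \<open>l\<close> to the right end of
  the base, inside the interval of the longer \<open>w\<close>. Bottom type: the new interval of
  \<open>l\<close> is the right end of the old interval of \<open>w\<close>, and \<open>T\<close>
  carries it onto the old interval of \<open>l\<close>. Either way the first image lies in the part
  cut off from the base.\<close>

lemma iet_interval_loser:
  assumes x: "x \<in> iet_interval T' l"
  shows "x \<in> iet_interval T l \<and> iet_map T x \<in> iet_interval T w \<or>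
         x \<in> iet_interval T w \<and> iet_map T x \<in> iet_interval T l"
    and "total_length T' \<le> iet_map T x"
    and "iet_map T' x = iet_map T (iet_map T x)"
proof -
  have "(x \<in> iet_interval T l \<and> iet_map T x \<in> iet_interval T w \<or>
         x \<in> iet_interval T w \<and> iet_map T x \<in> iet_interval T l) \<and>
        total_length T' \<le> iet_map T x \<and> iet_map T' x = iet_map T (iet_map T x)"
  proof (cases rule: arrow_cases)
    case top
    have xl: "x \<in> iet_interval T l"
      using x top neq by (auto simp: iet_interval_def len')
    have Tx: "iet_map T x = x + bot_left T l - top_left T l"
      by (rule iet_map_eq[OF data(1) xl])
    have Tw: "iet_map T x \<in> iet_interval T w"
      using xl Tx top len_less by (auto simp: iet_interval_def)
    show ?thesis
      using xl Tw Tx top iet_map_eq[OF data(1) Tw] iet_map_eq[OF data(2) x]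
      by (auto simp: total_length' iet_interval_def)
  next
    case bottom
    have xw: "x \<in> iet_interval T w"
      using x bottom neq len_less by (auto simp: iet_interval_def len')
    have Tx: "iet_map T x = x + bot_left T w - top_left T w"
      by (rule iet_map_eq[OF data(1) xw])
    have Tl: "iet_map T x \<in> iet_interval T l"
      using x xw Tx bottom neq by (auto simp: iet_interval_def len')
    show ?thesis
      using xw Tl Tx bottom iet_map_eq[OF data(1) Tl] iet_map_eq[OF data(2) x]
      by (auto simp: total_length' iet_interval_def)
  qed
  then show "x \<in> iet_interval T l \<and> iet_map T x \<in> iet_interval T w \<or>
         x \<in> iet_interval T w \<and> iet_map T x \<in> iet_interval T l"
    and "total_length T' \<le> iet_map T x"
    and "iet_map T' x = iet_map T (iet_map T x)" by blast+
qed

text \<open>Induction on \<open>m\<close>, peeling off one step of \<open>T'\<close>. It spends one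
  step of \<open>T\<close>, or two over the loser; the orbit cannot end in the middle of such a
  pair, because that point lies outside the new base.\<close>

lemma return_orbit:
  assumes "x \<in> {0..<total_length T'}" "(iet_map T ^^ m) x \<in> {0..<total_length T'}"
  shows "\<exists>m'\<le>m. (m \<ge> 1 \<longrightarrow> m' \<ge> 1) \<and> (iet_map T' ^^ m') x = (iet_map T ^^ m) x"
  using assms
proof (induction m arbitrary: x rule: less_induct)
  case (less m)
  obtain a where a: "x \<in> iet_interval T' a" using ex_iet_interval[OF data(2) less.prems(1)] by blast
  have T'x: "iet_map T' x \<in> {0..<total_length T'}" by (rule iet_map_in[OF data(2) less.prems(1)])
  consider "m = 0" | k where "m = Suc k" "a \<noteq> l" | "m = 1" "a = l" | k where "m = Suc (Suc k)" "a = l"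
    by (metis One_nat_def not0_implies_Suc)
  then show ?case
  proof cases
    case (2 k)
    then have "\<exists>m'\<le>k. (k \<ge> 1 \<longrightarrow> m' \<ge> 1) \<and>
        (iet_map T' ^^ m') (iet_map T' x) = (iet_map T ^^ k) (iet_map T' x)"
      using less.prems T'x iet_interval_nonloser(2)[OF a]
      by (intro less.IH) (auto simp: funpow_swap1 simp del: funpow.simps simp add: funpow_Suc_right)
    then obtain m' where "m' \<le> k" "(iet_map T' ^^ m') (iet_map T' x) = (iet_map T ^^ k) (iet_map T' x)"
      by blast
    then show ?thesis using 2 iet_interval_nonloser(2)[OF a]
      by (intro exI[of _ "Suc m'"]) (simp add: funpow_Suc_right del: funpow.simps)
  next
    case 3
    then have "total_length T' \<le> iet_map T x" using a by (intro iet_interval_loser(2)) simp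
    then show ?thesis using less.prems(2) 3 by simp
  next
    case (4 k)
    then have "\<exists>m'\<le>k. (k \<ge> 1 \<longrightarrow> m' \<ge> 1) \<and>
        (iet_map T' ^^ m') (iet_map T' x) = (iet_map T ^^ k) (iet_map T' x)"
      using less.prems T'x iet_interval_loser(3) a
      by (intro less.IH) (auto simp del: funpow.simps simp add: funpow_Suc_right)
    then obtain m' where "m' \<le> k" "(iet_map T' ^^ m') (iet_map T' x) = (iet_map T ^^ k) (iet_map T' x)"
      by blast
    then show ?thesis using 4 iet_interval_loser(3) a
      by (intro exI[of _ "Suc m'"]) (simp add: funpow_Suc_right del: funpow.simps)
  qed auto
qed

end

section \<open>Persistence of connections under a step\<close>

definition connection :: "'a::finite iet \<Rightarrow> 'a \<Rightarrow> 'a \<Rightarrow> nat \<Rightarrow> bool" where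
  "connection T a b m \<longleftrightarrow>
    1 \<le> m \<and> (iet_map T ^^ m) (top_left T a) = top_left T b \<and> top_pos T b > 1"

context rauzy_step
begin

text \<open>A top left endpoint moves only for the loser of a bottom step, and then to its preimage
  under \<open>T\<close>. A connection ending there is cut by one step; one starting there is
  rejoined after one step of \<open>T'\<close>. The strict drop bounds how often the target can
  move.\<close>

lemma connection_step:
  assumes conn: "connection T a b m"
  shows "\<exists>m'\<le>m. connection T' a b m' \<and> (top_left T' b \<noteq> top_left T b \<longrightarrow> m' < m)"
proof -
  have m: "1 \<le> m" and orb: "(iet_map T ^^ m) (top_left T a) = top_left T b"
    and b: "top_pos T b > 1" using conn by (auto simp: connection_def)
  have in': "top_left T' c \<in> {0..<total_length T'}" for c
    using top_left_in_interval[OF data(2)] iet_interval_subset[OF data(2)] by blast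
  show ?thesis
  proof (cases rule: arrow_cases)
    case top
    obtain m' where "m' \<le> m" "m' \<ge> 1" "(iet_map T' ^^ m') (top_left T a) = top_left T b"
      using return_orbit[of "top_left T a" m] in'[of a] in'[of b] orb m top(6) by auto
    then show ?thesis using top(3,6) b by (auto simp: connection_def)
  next
    case bottom
    have pos_b: "top_pos T' b > 1"
      using b bottom top.range(1)[of w] by (auto simp: move_after_def)
    let ?p = "top_left T' l"
    have Tp: "iet_map T ?p = top_left T l"
    proof -
      have "?p \<in> iet_interval T w"
        using bottom len_less top.pos[of l] by (simp add: iet_interval_def)
      then show ?thesis using bottom by (simp add: iet_map_eq[OF data(1)])
    qed
    have sub: "{0..<total_length T'} \<subseteq> {0..<total_length T}"
      using total_length' top.pos[of l] by auto
    have T'p: "iet_map T' ?p = iet_map T (top_left T l)"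
      using iet_interval_loser(3)[OF top_left_in_interval[OF data(2)]] Tp by simp
    \<comment> \<open>If \<open>b\<close> is the loser, \<open>T\<close> maps its new left endpoint to the old one, so the orbit ends one step earlier.\<close>
    define k where "k = (if b = l then m - 1 else m)"
    have orb_k: "(iet_map T ^^ k) (top_left T a) = top_left T' b"
    proof (cases "b = l")
      case True
      have "?p \<in> {0..<total_length T}" using in'[of l] sub by blast
      moreover have "iet_map T ((iet_map T ^^ k) (top_left T a)) = iet_map T ?p"
        using orb m True Tp by (cases m) (auto simp: k_def)
      moreover have "(iet_map T ^^ k) (top_left T a) \<in> {0..<total_length T}"
        by (intro iet_map_funpow_in[OF data(1)] subsetD[OF iet_interval_subset[OF data(1), of a]]
            top_left_in_interval[OF data(1)])
      ultimately show ?thesis unfolding True using iet_map_inj[OF data(1)] by metis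
    next
      case False
      then show ?thesis using orb bottom by (simp add: k_def)
    qed
    \<comment> \<open>Otherwise \<open>m = 1\<close>, \<open>b = l\<close>, and the old left
      endpoint of \<open>a\<close> is the new one of \<open>l\<close>. For \<open>a = l\<close> the
      old endpoint is \<open>total_length T'\<close>, outside the new base; for other
      \<open>a\<close> two letters of \<open>T'\<close> would share a left endpoint.\<close>
    have "k \<noteq> 0"
    proof
      assume "k = 0"
      with m orb_k have p: "top_left T a = ?p" by (auto simp: k_def split: if_splits)
      show False
      proof (cases "a = l")
        case True
        then show False using in'[of l] bottom(5) total_length' p by auto
      next
        case False
        then have "?p \<in> iet_interval T' a"
          using p bottom(7)[of a] top_left_in_interval[OF data(2), of a] by simp
        then show False
          using False top'.interval_unique[of ?p a l] top_left_in_interval[OF data(2), of l]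
          unfolding iet_interval_def top_left_eq by blast
      qed
    qed
    have "\<exists>m'\<le>k. m' \<ge> 1 \<and> (iet_map T' ^^ m') (top_left T' a) = top_left T' b"
    proof (cases "a = l")
      case True
      \<comment> \<open>By \<open>T'p\<close> the orbit of the new endpoint under \<open>T'\<close>
        meets that of the old one under \<open>T\<close> after one step; only the remaining
        \<open>j\<close> steps go to \<open>return_orbit\<close>.\<close>
      obtain j where j: "k = Suc j" using \<open>k \<noteq> 0\<close> by (cases k) auto
      have orb_j: "(iet_map T ^^ j) (iet_map T' ?p) = top_left T' b"
        using orb_k j True T'p by (simp add: funpow_Suc_right del: funpow.simps)
      have "iet_map T' ?p \<in> {0..<total_length T'}" by (rule iet_map_in[OF data(2) in'])
      then obtain m' where "m' \<le> j" "(iet_map T' ^^ m') (iet_map T' ?p) = top_left T' b"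
        using return_orbit[of "iet_map T' ?p" j] orb_j in'[of b] by auto
      then show ?thesis using True j
        by (intro exI[of _ "Suc m'"]) (simp add: funpow_Suc_right del: funpow.simps)
    next
      case False
      then show ?thesis
        using return_orbit[of "top_left T' a" k] orb_k in'[of a] in'[of b] bottom(7)[of a] \<open>k \<noteq> 0\<close>
        by auto
    qed
    then obtain m' where "m' \<le> k" "connection T' a b m'"
      using pos_b by (auto simp: connection_def)
    moreover have "k \<le> m" "top_left T' b \<noteq> top_left T b \<longrightarrow> k < m"
      using bottom(7)[of b] m by (simp_all add: k_def)
    ultimately show ?thesis by (intro exI[of _ m'] conjI impI) (simp_all add: order_le_less_trans)
  qed
qed

end

context rauzy_step
begin

text \<open>\<open>len_less\<close> settles the comparison of lengths, so the algorithm takes the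
  prescribed arrow.\<close>

lemma winner_eq: "winner T = w" and rauzy_veech_eq: "rauzy_veech T = T'"
proof -
  have last_top: "last_top T = c" if "top_pos T c = CARD('a)" for c
    unfolding last_top_def using that top.inj by (metis (mono_tags, lifting) the_equality)
  have last_bot: "last_bot T = c" if "bot_pos T c = CARD('a)" for c
    unfolding last_bot_def using that bot.inj by (metis (mono_tags, lifting) the_equality)
  have "winner T = w \<and> rauzy_veech T = T'"
    using arrow unfolding rauzy_arrow_def
  proof (elim conjE disjE)
    assume a: "top_pos T w = CARD('a)" "bot_pos T l = CARD('a)"
      "top_pos T' = top_pos T" "bot_pos T' = move_after (bot_pos T) l w"
    then show ?thesis
      using last_top[OF a(1)] last_bot[OF a(2)] len_less len'
      by (cases T') (simp add: winner_def loser_def rauzy_veech_def)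
  next
    assume a: "bot_pos T w = CARD('a)" "top_pos T l = CARD('a)"
      "bot_pos T' = bot_pos T" "top_pos T' = move_after (top_pos T) l w"
    then show ?thesis
      using last_bot[OF a(1)] last_top[OF a(2)] len_less len'
      by (cases T') (simp add: winner_def loser_def rauzy_veech_def)
  qed
  then show "winner T = w" "rauzy_veech T = T'" by auto
qed

end

section \<open>Infinite Rauzy paths\<close>

text \<open>Stated for nonnegative lengths because it also serves to establish their positivity.
  Steps are written backward: the winner regains the length of the loser.\<close>

lemma lengths_antimono:
  fixes lam :: "nat \<Rightarrow> 'a \<Rightarrow> real"
  assumes "\<And>n a. 0 \<le> lam n a"
    and step: "\<And>n. lam n = (lam (Suc n))(w n := lam (Suc n) (w n) + lam (Suc n) (l n))"
    and "m \<le> n"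
  shows "lam n a \<le> lam m a"
  using \<open>m \<le> n\<close>
proof (induction n rule: dec_induct)
  case (step n)
  have "lam (Suc n) a \<le> lam n a"
    using assms(1)[of "Suc n" "l n"] by (subst (2) assms(2)) simp
  then show ?case using step by simp
qed simp

locale rauzy_path =
  fixes pt pb :: "nat \<Rightarrow> 'a::finite \<Rightarrow> nat" and w l :: "nat \<Rightarrow> 'a" and lam :: "nat \<Rightarrow> 'a \<Rightarrow> real"
  assumes bij_top: "\<And>n. bij_betw (pt n) UNIV {1..CARD('a)}"
    and bij_bot: "\<And>n. bij_betw (pb n) UNIV {1..CARD('a)}"
    and arrow: "\<And>n. rauzy_arrow (pt n) (pb n) (w n) (l n) (pt (Suc n)) (pb (Suc n))"
    and lam_pos: "\<And>n a. lam n a > 0"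
    and lam_step: "\<And>n. lam n = (lam (Suc n))(w n := lam (Suc n) (w n) + lam (Suc n) (l n))"
begin

definition iet_at :: "nat \<Rightarrow> 'a iet" where
  "iet_at n = \<lparr>top_pos = pt n, bot_pos = pb n, len = lam n\<rparr>"

lemma iet_data_at: "iet_data (iet_at n)"
  using bij_top bij_bot lam_pos by (simp add: iet_data_def iet_at_def)

lemma step: "rauzy_step (iet_at n) (iet_at (Suc n)) (w n) (l n)"
proof
  have "w n \<noteq> l n" using arrow[of n] by (simp add: rauzy_arrow_def)
  then show "len (iet_at (Suc n)) =
      (len (iet_at n))(w n := len (iet_at n) (w n) - len (iet_at n) (l n))"
    using lam_step[of n] by (simp add: iet_at_def)
qed (use arrow[of n] iet_data_at in \<open>simp_all add: iet_at_def\<close>)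

lemma rv_iter_at: "rv_iter (iet_at 0) n = iet_at n"
  by (induction n) (simp_all add: rv_iter_def rauzy_step.rauzy_veech_eq[OF step])

lemma winner_at: "winner (iet_at n) = w n"
  by (rule rauzy_step.winner_eq[OF step])

lemma total_length_at: "total_length (iet_at n) = sum (lam n) UNIV"
  by (simp add: total_length_def iet_at_def)

lemma lam_antimono:
  assumes "m \<le> n"
  shows "lam n a \<le> lam m a"
proof (rule lengths_antimono[of lam w l, OF _ lam_step assms])
  show "0 \<le> lam n a" for n a using lam_pos by (rule less_imp_le)
qed

lemma total_length_at_le: "total_length (iet_at n) \<le> total_length (iet_at 0)"
  unfolding total_length_at by (intro sum_mono lam_antimono) simp

lemma total_length_at_pos: "0 < total_length (iet_at n)"
  unfolding total_length_at using lam_pos by (intro sum_pos) auto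

text \<open>Heights of the Rauzy towers, equal to the row sums of \<open>Q(0,n)\<close>.\<close>

primrec height :: "nat \<Rightarrow> 'a \<Rightarrow> nat" where
  "height 0 = (\<lambda>_. 1)"
| "height (Suc n) = (height n)(l n := height n (l n) + height n (w n))"

lemma height_le: "height n a \<le> 2 ^ n"
proof (induction n arbitrary: a)
  case (Suc n)
  show ?case using Suc[of a] Suc[of "l n"] Suc[of "w n"] by (cases "a = l n") simp_all
qed simp

lemma height_pos: "1 \<le> height n a"
proof (induction n arbitrary: a)
  case (Suc n)
  show ?case using Suc[of a] Suc[of "l n"] by (cases "a = l n") simp_all
qed simp

lemma height_const:
  assumes "m \<le> n" "\<And>i. m \<le> i \<Longrightarrow> i < n \<Longrightarrow> l i \<noteq> a"
  shows "height n a = height m a"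
  using assms
proof (induction n rule: dec_induct)
  case (step n)
  then have "height n a = height m a" "l n \<noteq> a" by auto
  then show ?case by simp
qed simp

lemma iet_map_at:
  assumes "x \<in> iet_interval (iet_at n) a"
  shows "iet_map (iet_at n) x = (iet_map (iet_at 0) ^^ height n a) x"
  using assms
proof (induction n arbitrary: x a)
  case (Suc n)
  interpret rauzy_step "iet_at n" "iet_at (Suc n)" "w n" "l n" by (rule step)
  show ?case
  proof (cases "a = l n")
    case False
    then show ?thesis using iet_interval_nonloser[OF Suc.prems] Suc.IH by simp
  next
    case True
    then have x: "x \<in> iet_interval (iet_at (Suc n)) (l n)" using Suc.prems by simp
    from iet_interval_loser(1)[OF x] obtain b c
      where "x \<in> iet_interval (iet_at n) b" "iet_map (iet_at n) x \<in> iet_interval (iet_at n) c"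
        \<comment> \<open>The orbit visits \<open>l n\<close> and \<open>w n\<close> in an order
          that depends on the type; the sum of the heights does not.\<close>
        and bc: "height n (l n) + height n (w n) = height n c + height n b"
      by (metis add.commute)
    then have "iet_map (iet_at n) (iet_map (iet_at n) x) =
        (iet_map (iet_at 0) ^^ height n c) ((iet_map (iet_at 0) ^^ height n b) x)"
      using Suc.IH by metis
    also have "\<dots> = (iet_map (iet_at 0) ^^ (height n c + height n b)) x"
      by (simp add: funpow_add)
    finally show ?thesis using True iet_interval_loser(3)[OF x] bc by simp
  qed
qed simp

text \<open>The minimal time of a persisting connection drops only finitely often, so its target
  endpoint is eventually constant. This endpoint is positive and lies in every later base, although
  the bases shrink to 0.\<close>

lemma keane_at_0:
  assumes small: "\<And>\<epsilon>. \<epsilon> > 0 \<Longrightarrow> \<exists>n. total_length (iet_at n) < \<epsilon>"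
  shows "keane (iet_at 0)"
proof (rule ccontr)
  assume "\<not> keane (iet_at 0)"
  then obtain a b m where 0: "connection (iet_at 0) a b m"
    by (auto simp: keane_def connection_def)
  define \<mu> where "\<mu> n = (LEAST m. connection (iet_at n) a b m)" for n
  have conn: "\<exists>m. connection (iet_at n) a b m" for n
  proof (induction n)
    case (Suc n)
    then show ?case using rauzy_step.connection_step[OF step] by meson
  qed (use 0 in blast)
  have \<mu>: "connection (iet_at n) a b (\<mu> n)" for n
    unfolding \<mu>_def using conn by (rule LeastI_ex)
  have step_\<mu>: "\<mu> (Suc n) \<le> \<mu> n \<and>
      (top_left (iet_at (Suc n)) b \<noteq> top_left (iet_at n) b \<longrightarrow> \<mu> (Suc n) < \<mu> n)" for n
  proof -
    obtain m' where "m' \<le> \<mu> n" "connection (iet_at (Suc n)) a b m'"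
      "top_left (iet_at (Suc n)) b \<noteq> top_left (iet_at n) b \<longrightarrow> m' < \<mu> n"
      using rauzy_step.connection_step[OF step \<mu>] by blast
    moreover from this have "\<mu> (Suc n) \<le> m'" unfolding \<mu>_def by (intro Least_le)
    ultimately show ?thesis by auto
  qed
  have anti: "\<mu> n \<le> \<mu> m" if "m \<le> n" for m n
    by (rule lift_Suc_antimono_le[OF _ that]) (simp add: step_\<mu>)
  \<comment> \<open>From \<open>N\<close> on the minimal time cannot drop, so the target cannot
    move.\<close>
  obtain N where N: "\<And>n. \<mu> N \<le> \<mu> n"
    using ex_has_least_nat[of "\<lambda>_. True" 0 \<mu>] by auto
  have const: "top_left (iet_at n) b = top_left (iet_at N) b" if "N \<le> n" for n
    using that
  proof (induction n rule: dec_induct)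
    case (step n)
    have "\<not> \<mu> (Suc n) < \<mu> n" using anti[OF step(1)] N[of "Suc n"] by linarith
    then show ?case using step_\<mu>[of n] step.IH by metis
  qed simp
  have "top_pos (iet_at N) b > 1" using \<mu>[of N] by (simp add: connection_def)
  then have pos: "top_left (iet_at N) b > 0"
    unfolding top_left_eq by (rule positioned_lengths.left_end_pos[OF iet_data_top[OF iet_data_at]])
  from small[OF pos] obtain n where n: "total_length (iet_at n) < top_left (iet_at N) b" by blast
  have *: "top_left (iet_at k) b < total_length (iet_at k)" for k
    using top_left_in_interval[OF iet_data_at] iet_interval_subset[OF iet_data_at] by fastforce
  show False
  proof (cases "N \<le> n")
    case True
    then show False using const[OF True] *[of n] n by simp
  next
    case False
    then have "total_length (iet_at N) \<le> total_length (iet_at n)"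
      unfolding total_length_at by (intro sum_mono lam_antimono) simp
    then show False using *[of N] n by simp
  qed
qed

text \<open>With \<open>r\<close> the length of the base at level \<open>n\<close> and
  \<open>x\<close> in the interval of \<open>a\<close>, the orbit of \<open>x\<close> is back in the
  base after \<open>height n a\<close> steps. This is at most \<open>r\<close> to the power -1/2, so
  the quotient in (U) is at most 1/2.\<close>

lemma not_condition_U_at_0:
  assumes early: "\<And>\<epsilon>. \<epsilon> > 0 \<Longrightarrow>
    \<exists>n a. total_length (iet_at n) < \<epsilon> \<and> (real (height n a))\<^sup>2 * total_length (iet_at n) \<le> 1"
  shows "\<not> condition_U (iet_at 0)"
proof
  assume "condition_U (iet_at 0)"
  then have "\<forall>\<^sub>F r in at_right 0. \<forall>x\<in>{0..<total_length (iet_at 0)}.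
      dist (ln (real (return_time (iet_at 0) r x)) / (- ln r)) 1 < 1 / 2"
    unfolding condition_U_def by (intro uniform_limitD) auto
  then obtain \<delta> where "\<delta> > 0" and \<delta>: "\<And>r x. 0 < r \<Longrightarrow> r < \<delta> \<Longrightarrow> x \<in> {0..<total_length (iet_at 0)} \<Longrightarrow>
      dist (ln (real (return_time (iet_at 0) r x)) / (- ln r)) 1 < 1 / 2"
    unfolding eventually_at_right_field by auto
  \<comment> \<open>The bound 1 makes \<open>- ln r\<close> positive.\<close>
  obtain n a where small: "total_length (iet_at n) < min 1 \<delta>"
    and h: "(real (height n a))\<^sup>2 * total_length (iet_at n) \<le> 1"
    using early[of "min 1 \<delta>"] \<open>\<delta> > 0\<close> by auto
  define r where "r = total_length (iet_at n)"
  define x where "x = top_left (iet_at n) a"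
  define j where "j = return_time (iet_at 0) r x"
  have r: "0 < r" "r < 1" "r < \<delta>" using small total_length_at_pos by (simp_all add: r_def)
  have x: "x \<in> iet_interval (iet_at n) a" unfolding x_def by (rule top_left_in_interval[OF iet_data_at])
  then have xr: "x \<in> {0..<r}" using iet_interval_subset[OF iet_data_at] unfolding r_def by blast
  then have "iet_map (iet_at n) x \<in> {0..<r}" unfolding r_def by (rule iet_map_in[OF iet_data_at])
  with xr have close: "\<bar>(iet_map (iet_at 0) ^^ height n a) x - x\<bar> < r"
    unfolding iet_map_at[OF x] by auto
  let ?P = "\<lambda>j. j \<ge> 1 \<and> \<bar>(iet_map (iet_at 0) ^^ j) x - x\<bar> < r"
  have "?P (height n a)" using close height_pos by blast
  then have "?P j" "j \<le> height n a"
    unfolding j_def return_time_def by (rule LeastI, rule Least_le)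
  then have j: "1 \<le> real j" "real j \<le> real (height n a)" by auto
  have "ln (real j) \<le> ln (real (height n a))" using j by simp
  moreover have "2 * ln (real (height n a)) + ln r \<le> 0"
  proof -
    have pos: "0 < real (height n a)" using j by linarith
    then have "2 * ln (real (height n a)) + ln r = ln ((real (height n a))\<^sup>2 * r)"
      using r(1) by (simp add: ln_mult ln_realpow)
    also have "\<dots> \<le> ln 1" using h pos r(1) unfolding r_def by (subst ln_le_cancel_iff) auto
    finally show ?thesis by simp
  qed
  ultimately have "ln (real j) \<le> - ln r / 2" by linarith
  moreover have "- ln r > 0" using r by simp
  ultimately have "ln (real j) / (- ln r) \<le> 1 / 2"
    by (subst pos_divide_le_eq) auto
  moreover have "x \<in> {0..<total_length (iet_at 0)}"
    using xr total_length_at_le[of n] by (auto simp: r_def)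
  ultimately show False using \<delta>[OF r(1,3), of x] unfolding j_def[symmetric] dist_real_def by linarith
qed

end

section \<open>Bounded Zorich matrices\<close>

lemma step_matrix_mult_entry:
  "(step_matrix T ** M) $ i $ j = M $ i $ j + (if i = loser T then M $ winner T $ j else 0)"
proof -
  have "(step_matrix T ** M) $ i $ j =
    (\<Sum>k\<in>UNIV. (if i = k then M $ k $ j else 0) +
      (if k = winner T then (if i = loser T then M $ k $ j else 0) else 0))"
    unfolding matrix_matrix_mult_def step_matrix_def mat_def
    by (auto intro!: sum.cong simp: distrib_right)
  then show ?thesis by (simp add: sum.distrib)
qed

text \<open>The step adds one row of \<open>M\<close> to another.\<close>

lemma matrix_norm1_step:
  "matrix_norm1 (step_matrix T ** M) \<le> 2 * matrix_norm1 M"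
proof -
  have "matrix_norm1 (step_matrix T ** M) \<le> (\<Sum>i\<in>UNIV. \<Sum>j\<in>UNIV. \<bar>M $ i $ j\<bar> +
      (if i = loser T then \<bar>M $ winner T $ j\<bar> else 0))"
    unfolding matrix_norm1_def step_matrix_mult_entry by (intro sum_mono) auto
  also have "\<dots> = matrix_norm1 M + (\<Sum>i\<in>UNIV. if i = loser T then \<Sum>j\<in>UNIV. \<bar>M $ winner T $ j\<bar> else 0)"
  proof -
    have "(\<Sum>j\<in>UNIV. if i = loser T then \<bar>M $ winner T $ j\<bar> else 0) =
        (if i = loser T then \<Sum>j\<in>UNIV. \<bar>M $ winner T $ j\<bar> else 0)" for i
      by simp
    then show ?thesis unfolding matrix_norm1_def sum.distrib by simp
  qed
  also have "\<dots> = matrix_norm1 M + (\<Sum>j\<in>UNIV. \<bar>M $ winner T $ j\<bar>)" by simp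
  also have "(\<Sum>j\<in>UNIV. \<bar>M $ winner T $ j\<bar>) \<le> matrix_norm1 M"
    unfolding matrix_norm1_def by (rule member_le_sum) (auto intro: sum_nonneg)
  finally show ?thesis by simp
qed

lemma matrix_norm1_rv_matrix_le:
  fixes T :: "'a::finite iet"
  shows "matrix_norm1 (rv_matrix T m n) \<le> CARD('a) * 2 ^ (n - m)"
proof -
  have one: "matrix_norm1 (mat 1 :: real^'a^'a) = CARD('a)"
    by (simp add: matrix_norm1_def mat_def)
  show ?thesis
  proof (induction n)
    case (Suc n)
    show ?case
    proof (cases "m \<le> n")
      case True
      then show ?thesis
        using Suc matrix_norm1_step[of "rv_iter T n" "rv_matrix T m n"] by (simp add: Suc_diff_le)
    qed (simp add: one)
  qed (simp add: one)
qed

lemma rv_matrix_entries: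
  "0 \<le> rv_matrix T m n $ i $ j" "1 \<le> rv_matrix T m n $ i $ i"
proof (induction n arbitrary: i j)
  case (Suc n)
  case 1
  show ?case using Suc by (auto simp: step_matrix_mult_entry mat_def)
  case 2
  show ?case using Suc by (auto simp: step_matrix_mult_entry mat_def intro: add_increasing2)
qed (auto simp: mat_def)

text \<open>Ensures that the factor with exponent \<epsilon> in (Z) is at least 1. One diagonal
  entry suffices.\<close>

lemma matrix_norm1_rv_matrix_ge: "1 \<le> matrix_norm1 (rv_matrix T m n)"
proof -
  fix i
  have "1 \<le> \<bar>rv_matrix T m n $ i $ i\<bar>" using rv_matrix_entries(2)[of T m n i] by simp
  also have "\<dots> \<le> (\<Sum>j\<in>UNIV. \<bar>rv_matrix T m n $ i $ j\<bar>)" by (rule member_le_sum) auto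
  also have "\<dots> \<le> matrix_norm1 (rv_matrix T m n)"
    unfolding matrix_norm1_def
    by (rule member_le_sum[of i UNIV "\<lambda>i. \<Sum>j\<in>UNIV. \<bar>rv_matrix T m n $ i $ j\<bar>"]) (auto intro: sum_nonneg)
  finally show ?thesis .
qed

text \<open>A Zorich step then consists of at most \<open>L\<close> steps, each at most doubling the
  norm, so one constant serves for all \<epsilon>.\<close>

lemma condition_Z_if_winners_change:
  fixes T :: "'a::finite iet"
  assumes change: "\<And>n. \<exists>i\<in>{n..<n + L}. \<exists>j\<in>{n..<n + L}.
    winner (rv_iter T i) \<noteq> winner (rv_iter T j)"
  shows "condition_Z T"
proof -
  have time: "zorich_time T (Suc k) \<le> zorich_time T k + L" for k
  proof -
    define z where "z = zorich_time T k"
    let ?P = "\<lambda>n. n > z \<and> (\<exists>w. \<forall>i\<in>{z..<n}. winner (rv_iter T i) = w)"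
    \<comment> \<open>\<open>GREATEST\<close> is meaningful once the set is nonempty, by
      \<open>Suc z\<close>, and bounded, by \<open>bound\<close>.\<close>
    have "?P (Suc z)" by auto
    moreover have bound: "n \<le> z + L" if "?P n" for n
    proof (rule ccontr)
      assume "\<not> n \<le> z + L"
      then have "{z..<z + L} \<subseteq> {z..<n}" by auto
      with that obtain w where "\<forall>i\<in>{z..<z + L}. winner (rv_iter T i) = w" by blast
      then show False using change[of z] by auto
    qed
    ultimately have "?P (GREATEST n. ?P n)" by (rule GreatestI_nat[of ?P]) blast
    from bound[OF this] show ?thesis by (simp add: z_def)
  qed
  show ?thesis
    unfolding condition_Z_def
  proof (intro allI impI)
    fix \<epsilon> :: real assume "\<epsilon> > 0"
    have "matrix_norm1 (zorich_matrix T k (k + 1)) \<le>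
        real CARD('a) * 2 ^ L * matrix_norm1 (zorich_matrix T 0 k) powr \<epsilon>" for k
    proof -
      have "matrix_norm1 (zorich_matrix T k (k + 1)) \<le>
          real CARD('a) * 2 ^ (zorich_time T (Suc k) - zorich_time T k)"
        unfolding zorich_matrix_def using matrix_norm1_rv_matrix_le by simp
      also have "\<dots> \<le> real CARD('a) * 2 ^ L"
        using time[of k] by (intro mult_left_mono power_increasing) auto
      also have "\<dots> \<le> real CARD('a) * 2 ^ L * matrix_norm1 (zorich_matrix T 0 k) powr \<epsilon>"
        using ge_one_powr_ge_zero[OF matrix_norm1_rv_matrix_ge, of \<epsilon>] \<open>\<epsilon> > 0\<close>
        by (simp add: zorich_matrix_def)
      finally show ?thesis .
    qed
    then show "\<exists>C>0. \<forall>k\<ge>1. matrix_norm1 (zorich_matrix T k (k + 1)) \<le>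
        C * matrix_norm1 (zorich_matrix T 0 k) powr \<epsilon>"
      by (intro exI[of _ "real CARD('a) * 2 ^ L"]) simp
  qed
qed

section \<open>Lengths following a prescribed path\<close>

text \<open>The length update on all vectors; a negative entry shows that the vector does not follow
  the path. The type \<open>real^'a\<close> gives access to compactness.\<close>

definition forward_step :: "'a \<Rightarrow> 'a \<Rightarrow> real^'a::finite \<Rightarrow> real^'a" where
  "forward_step w l v = (\<chi> j. if j = w then v $ j - v $ l else v $ j)"

primrec forward_lengths :: "(nat \<Rightarrow> 'a) \<Rightarrow> (nat \<Rightarrow> 'a) \<Rightarrow> nat \<Rightarrow> real^'a::finite \<Rightarrow> real^'a" where
  "forward_lengths w l 0 v = v"
| "forward_lengths w l (Suc n) v = forward_step (w n) (l n) (forward_lengths w l n v)"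

lemma continuous_on_forward_lengths: "continuous_on UNIV (forward_lengths w l n)"
proof (induction n)
  case 0
  have "forward_lengths w l 0 = (\<lambda>v. v)" by (simp add: fun_eq_iff)
  then show ?case by simp
next
  case (Suc n)
  have "continuous_on UNIV (\<lambda>v. forward_step a b (forward_lengths w l n v))" for a b
    unfolding forward_step_def
  proof (rule continuous_on_vec_lambda)
    fix j
    show "continuous_on UNIV (\<lambda>v. if j = a then forward_lengths w l n v $ j -
        forward_lengths w l n v $ b else forward_lengths w l n v $ j)"
      by (cases "j = a") (simp_all add: Suc continuous_on_component continuous_on_diff)
  qed
  moreover have "forward_lengths w l (Suc n) =
      (\<lambda>v. forward_step (w n) (l n) (forward_lengths w l n v))"
    by (simp add: fun_eq_iff)
  ultimately show ?case by simp
qed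

lemma forward_lengths_scale: "forward_lengths w l n (c *\<^sub>R v) = c *\<^sub>R forward_lengths w l n v"
  by (induction n) (auto simp: forward_step_def vec_eq_iff algebra_simps)

text \<open>The inverse of a step adds the length of the loser to the winner, so going back from
  \<open>u\<close> preserves nonnegativity.\<close>

lemma ex_forward_lengths:
  assumes "\<And>n. w n \<noteq> l n" "\<And>j. 0 \<le> u $ j" "0 < (\<Sum>j\<in>UNIV. u $ j)"
  shows "\<exists>v. forward_lengths w l n v = u \<and> (\<forall>i\<le>n. \<forall>j. 0 \<le> forward_lengths w l i v $ j) \<and>
    0 < (\<Sum>j\<in>UNIV. v $ j)"
  using assms(2,3)
proof (induction n arbitrary: u)
  case 0
  then show ?case by auto
next
  case (Suc n)
  define u' where "u' = (\<chi> j. if j = w n then u $ j + u $ l n else u $ j)"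
  have u': "0 \<le> u' $ j" "u $ j \<le> u' $ j" for j using Suc.prems(1) by (auto simp: u'_def)
  have "(\<Sum>j\<in>UNIV. u $ j) \<le> (\<Sum>j\<in>UNIV. u' $ j)" by (intro sum_mono u')
  with Suc.prems Suc.IH[of u'] u' obtain v where v: "forward_lengths w l n v = u'"
    "\<forall>i\<le>n. \<forall>j. 0 \<le> forward_lengths w l i v $ j" "0 < (\<Sum>j\<in>UNIV. v $ j)"
    by auto
  moreover have "forward_lengths w l (Suc n) v = u"
    using v(1) assms(1)[of n] by (simp add: forward_step_def u'_def vec_eq_iff)
  ultimately show ?case using Suc.prems by (metis le_Suc_eq)
qed

text \<open>The length vectors compatible with the first \<open>n\<close> steps form a decreasing sequence of
  nonempty compact sets.\<close>

lemma ex_nonneg_lengths: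
  fixes w l :: "nat \<Rightarrow> 'a::finite"
  assumes "\<And>n. w n \<noteq> l n"
  shows "\<exists>lam. (\<forall>n a. 0 \<le> lam n a) \<and> sum (lam 0) UNIV = (1::real) \<and>
    (\<forall>n. lam n = (lam (Suc n))(w n := lam (Suc n) (w n) + lam (Suc n) (l n)))"
proof -
  \<comment> \<open>The normalization makes the sets bounded and excludes the zero vector.\<close>
  define K where "K n = {v. (\<Sum>j\<in>UNIV. v $ j) = 1 \<and> (\<forall>i\<le>n. \<forall>j. 0 \<le> forward_lengths w l i v $ j)}" for n
  have "closed (K n)" for n
  proof -
    have "closed {v. 0 \<le> forward_lengths w l i v $ j}" for i j
      by (intro closed_Collect_le continuous_intros continuous_on_forward_lengths)
    moreover have "closed {v::real^'a. (\<Sum>j\<in>UNIV. v $ j) = 1}"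
      by (intro closed_Collect_eq continuous_intros)
    moreover have "K n = {v. (\<Sum>j\<in>UNIV. v $ j) = 1} \<inter>
        (\<Inter>i\<in>{..n}. \<Inter>j. {v. 0 \<le> forward_lengths w l i v $ j})"
      by (auto simp: K_def)
    ultimately show ?thesis by (simp add: closed_Int closed_INT)
  qed
  moreover have "bounded (K n)" for n
  proof (rule boundedI)
    fix v assume v: "v \<in> K n"
    then have "0 \<le> v $ j" for j unfolding K_def by (force dest: spec[of _ 0])
    then have "(\<Sum>j\<in>UNIV. \<bar>v $ j\<bar>) = 1" using v by (simp add: K_def)
    then show "norm v \<le> 1" using norm_le_l1_cart[of v] by simp
  qed
  ultimately have "compact (K n)" for n by (simp add: compact_eq_bounded_closed)
  moreover have "K n \<noteq> {}" for n
  proof -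
    obtain v where v: "\<forall>i\<le>n. \<forall>j. 0 \<le> forward_lengths w l i v $ j" "0 < (\<Sum>j\<in>UNIV. v $ j)"
      using ex_forward_lengths[of w l "\<chi> _. 1" n] assms by auto
    then have "(1 / (\<Sum>j\<in>UNIV. v $ j)) *\<^sub>R v \<in> K n"
      by (auto simp: K_def forward_lengths_scale sum_divide_distrib[symmetric])
    then show ?thesis by blast
  qed
  moreover have "K n \<subseteq> K m" if "m \<le> n" for m n using that unfolding K_def by auto
  ultimately have "(\<Inter>n. K n) \<noteq> {}" by (intro compact_nest)
  \<comment> \<open>The common vector is only known to be nonnegative along the path; strict
    positivity comes later from the full loops.\<close>
  then obtain v where v: "\<And>n. v \<in> K n" by auto
  have "forward_lengths w l n v $ a = ((\<lambda>a. forward_lengths w l (Suc n) v $ a)(w n :=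
      forward_lengths w l (Suc n) v $ w n + forward_lengths w l (Suc n) v $ l n)) a" for n a
    using assms[of n] by (auto simp: forward_step_def)
  moreover have "0 \<le> forward_lengths w l n v $ a" for n a using v[of n] by (simp add: K_def)
  ultimately show ?thesis
    using v[of 0] by (intro exI[of _ "\<lambda>n a. forward_lengths w l n v $ a"]) (auto simp: K_def fun_eq_iff)
qed

section \<open>A path on four letters\<close>

text \<open>A letter missing from the list gets the length of the list, so injectivity is meant on
  \<open>set xs\<close> only.\<close>

primrec position :: "'a list \<Rightarrow> 'a \<Rightarrow> nat" where
  "position [] a = 0"
| "position (x # xs) a = (if a = x then 1 else Suc (position xs a))"

lemma position_bounds: "a \<in> set xs \<Longrightarrow> 1 \<le> position xs a \<and> position xs a \<le> length xs"
  by (induction xs) auto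

lemma inj_on_position: "inj_on (position xs) (set xs)"
proof (rule inj_onI)
  fix a b assume "a \<in> set xs" "b \<in> set xs" "position xs a = position xs b"
  then show "a = b"
    by (induction xs) (auto split: if_splits dest!: position_bounds)
qed

lemma bij_betw_position:
  assumes "distinct xs"
  shows "bij_betw (position xs) (set xs) {1..length xs}"
proof -
  have "position xs ` set xs \<subseteq> {1..length xs}" using position_bounds[of _ xs] by auto
  moreover have "card (position xs ` set xs) = length xs"
    using card_image[OF inj_on_position[of xs]] assms by (simp add: distinct_card)
  ultimately have "position xs ` set xs = {1..length xs}" by (intro card_subset_eq) auto
  then show ?thesis using inj_on_position[of xs] by (simp add: bij_betw_def)
qed

text \<open>An arrow is given by its starting point (the letters in top order and in bottom order),
  its winner and its loser.\<close>

type_synonym 'a arrow = "'a list \<times> 'a list \<times> 'a \<times> 'a"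

abbreviation top_row :: "'a arrow \<Rightarrow> 'a list" where "top_row x \<equiv> fst x"
abbreviation bot_row :: "'a arrow \<Rightarrow> 'a list" where "bot_row x \<equiv> fst (snd x)"
abbreviation arrow_winner :: "'a arrow \<Rightarrow> 'a" where "arrow_winner x \<equiv> fst (snd (snd x))"
abbreviation arrow_loser :: "'a arrow \<Rightarrow> 'a" where "arrow_loser x \<equiv> snd (snd (snd x))"

text \<open>An arrow does not store its end; this is read off as the start of the next
  arrow.\<close>

definition consecutive :: "'a::finite arrow \<Rightarrow> 'a arrow \<Rightarrow> bool" where
  "consecutive x y \<longleftrightarrow> rauzy_arrow (position (top_row x)) (position (bot_row x))
     (arrow_winner x) (arrow_loser x) (position (top_row y)) (position (bot_row y))"

text \<open>The positions of the loops with positive matrix. The gap after \<open>mixing_block j\<close> starts at time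
  \<open>s = 10 * (mixing_block j + 1)\<close>, when all heights are at most \<open>2 ^ s\<close>, and has length
  \<open>9 * 4 ^ s\<close>; the factor \<open>9\<close> bounds the ratio of the total length to the length of \<open>C\<close> at the
  beginning of a positive loop.\<close>

primrec mixing_block :: "nat \<Rightarrow> nat" where
  "mixing_block 0 = 0"
| "mixing_block (Suc j) = mixing_block j + 1 + 9 * 4 ^ (10 * (mixing_block j + 1))"

lemma mixing_block_ge: "j \<le> mixing_block j"
  by (induction j) (auto intro: le_SucI trans_le_add1)

lemma mixing_block_gap:
  assumes "mixing_block j < i" "i < mixing_block (Suc j)"
  shows "i \<notin> range mixing_block"
proof
  assume "i \<in> range mixing_block"
  then obtain k where k: "i = mixing_block k" by auto
  have mono: "mixing_block m \<le> mixing_block n" if "m \<le> n" for m n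
    by (rule lift_Suc_mono_le[OF _ that]) simp
  have "\<not> k \<le> j" "\<not> Suc j \<le> k" using mono[of k j] mono[of "Suc j" k] assms k by linarith+
  then show False by linarith
qed

section \<open>The two loops and the path composed of them\<close>

locale four_letters =
  fixes A B C D :: "'a::finite"
  assumes distinct_letters: "distinct [A, B, C, D]" and letters: "UNIV = {A, B, C, D}"
begin

lemma neqs: "A \<noteq> B" "A \<noteq> C" "A \<noteq> D" "B \<noteq> C" "B \<noteq> D" "C \<noteq> D"
  "B \<noteq> A" "C \<noteq> A" "D \<noteq> A" "C \<noteq> B" "D \<noteq> B" "D \<noteq> C"
  using distinct_letters by auto

lemma card_letters: "CARD('a) = 4"
  using distinct_letters by (simp add: letters)

lemma all_letters: "(\<forall>x. P x) \<longleftrightarrow> P A \<and> P B \<and> P C \<and> P D"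
proof -
  have "(\<forall>x. P x) \<longleftrightarrow> (\<forall>x\<in>UNIV. P x)" by simp
  then show ?thesis by (simp add: letters)
qed

lemma sum_letters: "sum f UNIV = f A + f B + f C + f D"
  using distinct_letters by (simp add: letters add.assoc)

text \<open>Both blocks are loops of the same length at the vertex \<open>(A B C D / D A C B)\<close> of the Rauzy
  diagram. The matrix of the first one is positive; the second one involves \<open>A\<close> neither as
  winner nor as loser.\<close>

definition full_loop :: "'a arrow list" where
  "full_loop =
    [([A, B, C, D], [D, A, C, B], B, D),
     ([A, B, D, C], [D, A, C, B], C, B),
     ([A, B, D, C], [D, A, C, B], B, C),
     ([A, B, C, D], [D, A, C, B], D, B),
     ([A, B, C, D], [D, B, A, C], C, D),
     ([A, B, C, D], [D, B, A, C], D, C),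
     ([A, B, C, D], [D, C, B, A], A, D),
     ([A, D, B, C], [D, C, B, A], A, C),
     ([A, C, D, B], [D, C, B, A], A, B),
     ([A, B, C, D], [D, C, B, A], D, A)]"

definition partial_loop :: "'a arrow list" where
  "partial_loop =
    [([A, B, C, D], [D, A, C, B], B, D),
     ([A, B, D, C], [D, A, C, B], C, B),
     ([A, B, D, C], [D, A, C, B], C, B),
     ([A, B, D, C], [D, A, C, B], B, C),
     ([A, B, C, D], [D, A, C, B], B, D),
     ([A, B, D, C], [D, A, C, B], C, B),
     ([A, B, D, C], [D, A, C, B], B, C),
     ([A, B, C, D], [D, A, C, B], B, D),
     ([A, B, D, C], [D, A, C, B], C, B),
     ([A, B, D, C], [D, A, C, B], B, C)]"

definition loop :: "bool \<Rightarrow> 'a arrow list" where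
  "loop full = (if full then full_loop else partial_loop)"

lemma length_loop: "length (loop full) = 10"
  by (simp add: loop_def full_loop_def partial_loop_def)

lemma loop_rows:
  assumes "x \<in> set (loop full)"
  shows "distinct (top_row x)" "set (top_row x) = UNIV" "length (top_row x) = 4"
    "distinct (bot_row x)" "set (bot_row x) = UNIV" "length (bot_row x) = 4"
  using assms distinct_letters
  by (auto simp: loop_def full_loop_def partial_loop_def letters neqs split: if_splits)

lemma consecutive_letters:
  fixes t b :: "'a list"
  shows "consecutive (t, b, w, l) (t', b', x) \<longleftrightarrow> w \<noteq> l \<and>
    (position t w = 4 \<and> position b l = 4 \<and>
      (\<forall>a. position t' a = position t a \<and> position b' a = move_after (position b) l w a) \<or>
     position b w = 4 \<and> position t l = 4 \<and>
      (\<forall>a. position b' a = position b a \<and> position t' a = move_after (position t) l w a))"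
  by (simp add: consecutive_def rauzy_arrow_def card_letters fun_eq_iff all_conj_distrib)

lemma consecutive_in_loop:
  assumes "r < 9"
  shows "consecutive (loop full ! r) (loop full ! Suc r)"
proof -
  have "r \<in> {0, 1, 2, 3, 4, 5, 6, 7, 8}" using assms by auto
  then show ?thesis
    by (cases full; elim insertE emptyE)
       (simp_all add: loop_def full_loop_def partial_loop_def consecutive_letters all_letters
         move_after_def neqs)
qed

text \<open>Both loops start and end at one vertex, so blocks can be concatenated in any
  order.\<close>

lemma consecutive_loops: "consecutive (loop full ! 9) (loop full' ! 0)"
  by (cases full; cases full')
     (simp_all add: loop_def full_loop_def partial_loop_def consecutive_letters all_letters
         move_after_def neqs)

definition arrows :: "nat \<Rightarrow> 'a arrow" where
  "arrows n = loop (n div 10 \<in> range mixing_block) ! (n mod 10)"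

lemma arrows_block: "r < 10 \<Longrightarrow> arrows (10 * q + r) = loop (q \<in> range mixing_block) ! r"
  by (simp add: arrows_def)

lemma arrows_in_loop: "arrows n \<in> set (loop (n div 10 \<in> range mixing_block))"
  unfolding arrows_def by (intro nth_mem) (simp add: length_loop)

lemma consecutive_arrows: "consecutive (arrows n) (arrows (Suc n))"
proof -
  define q r where "q = n div 10" and "r = n mod 10"
  have n: "n = 10 * q + r" "r < 10" by (simp_all add: q_def r_def)
  show ?thesis
  proof (cases "r = 9")
    case True
    then have "arrows (Suc n) = loop (Suc q \<in> range mixing_block) ! 0"
      using arrows_block[of 0 "Suc q"] n by simp
    then show ?thesis using consecutive_loops arrows_block[of 9 q] n True by simp
  next
    case False
    then have "arrows (Suc n) = loop (q \<in> range mixing_block) ! Suc r"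
      using arrows_block[of "Suc r" q] n by simp
    then show ?thesis using consecutive_in_loop[of r] arrows_block[of r q] n False by simp
  qed
qed

abbreviation "winner_seq n \<equiv> arrow_winner (arrows n)"
abbreviation "loser_seq n \<equiv> arrow_loser (arrows n)"

text \<open>The coefficients form the transpose of the matrix of the loop; all of them are
  positive.\<close>

lemma full_loop_lengths:
  fixes f :: "nat \<Rightarrow> 'a \<Rightarrow> real"
  assumes step: "\<forall>r<10. f r = (f (Suc r))(arrow_winner (full_loop ! r) :=
      f (Suc r) (arrow_winner (full_loop ! r)) + f (Suc r) (arrow_loser (full_loop ! r)))"
  shows "f 0 A = 2 * f 10 A + f 10 B + f 10 C + f 10 D"
    "f 0 B = 2 * f 10 A + 2 * f 10 B + 3 * f 10 C + 2 * f 10 D"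
    "f 0 C = 2 * f 10 A + f 10 B + 4 * f 10 C + 2 * f 10 D"
    "f 0 D = f 10 A + f 10 B + f 10 C + f 10 D"
proof -
  have 0: "f 0 = (f 1)(B := f 1 B + f 1 D)"
    using step[THEN spec, of 0] by (simp add: full_loop_def)
  have 1: "f 1 = (f 2)(C := f 2 C + f 2 B)"
    using step[THEN spec, of 1] by (simp add: full_loop_def numeral_2_eq_2)
  have 2: "f 2 = (f 3)(B := f 3 B + f 3 C)"
    using step[THEN spec, of 2] by (simp add: full_loop_def)
  have 3: "f 3 = (f 4)(D := f 4 D + f 4 B)"
    using step[THEN spec, of 3] by (simp add: full_loop_def)
  have 4: "f 4 = (f 5)(C := f 5 C + f 5 D)"
    using step[THEN spec, of 4] by (simp add: full_loop_def)
  have 5: "f 5 = (f 6)(D := f 6 D + f 6 C)"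
    using step[THEN spec, of 5] by (simp add: full_loop_def)
  have 6: "f 6 = (f 7)(A := f 7 A + f 7 D)"
    using step[THEN spec, of 6] by (simp add: full_loop_def)
  have 7: "f 7 = (f 8)(A := f 8 A + f 8 C)"
    using step[THEN spec, of 7] by (simp add: full_loop_def)
  have 8: "f 8 = (f 9)(A := f 9 A + f 9 B)"
    using step[THEN spec, of 8] by (simp add: full_loop_def)
  have 9: "f 9 = (f 10)(D := f 10 D + f 10 A)"
    using step[THEN spec, of 9] by (simp add: full_loop_def)
  show "f 0 A = 2 * f 10 A + f 10 B + f 10 C + f 10 D"
    "f 0 B = 2 * f 10 A + 2 * f 10 B + 3 * f 10 C + 2 * f 10 D"
    "f 0 C = 2 * f 10 A + f 10 B + 4 * f 10 C + 2 * f 10 D"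
    "f 0 D = f 10 A + f 10 B + f 10 C + f 10 D"
    unfolding 0 1 2 3 4 5 6 7 8 9 by (simp_all add: neqs)
qed

end

section \<open>Lengths along the path and verification of the conditions\<close>

context four_letters
begin

theorem ex_condition_Z_not_U:
  "\<exists>T :: 'a iet. iet_data T \<and> admissible T \<and> keane T \<and> total_length T = 1 \<and>
     condition_Z T \<and> \<not> condition_U T"
proof -
  have neq: "winner_seq n \<noteq> loser_seq n" for n
    using consecutive_arrows[of n] by (simp add: consecutive_def rauzy_arrow_def)
  from ex_nonneg_lengths[of "\<lambda>n. winner_seq n" "\<lambda>n. loser_seq n", OF neq]
  obtain lam :: "nat \<Rightarrow> 'a \<Rightarrow> real" where lam: "\<forall>n a. 0 \<le> lam n a"
    "\<forall>n. lam n = (lam (Suc n))(winner_seq n :=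
      lam (Suc n) (winner_seq n) + lam (Suc n) (loser_seq n))"
    and total: "sum (lam 0) UNIV = 1"
    by (elim exE conjE)
  note nonneg = lam(1)[rule_format] and step = lam(2)[rule_format]
  have anti: "lam n a \<le> lam m a" if "m \<le> n" for m n a
    by (rule lengths_antimono[of lam "\<lambda>n. winner_seq n" "\<lambda>n. loser_seq n", OF nonneg step that])
  have le_1: "lam n a \<le> 1" for n a
  proof -
    have "lam n a \<le> lam 0 a" by (rule anti) simp
    also have "\<dots> \<le> sum (lam 0) UNIV" by (rule member_le_sum) (simp_all add: nonneg)
    finally show ?thesis by (simp add: total)
  qed

  have mix: "sum (lam (10 * mixing_block j + 10)) UNIV \<le> lam (10 * mixing_block j) a"
    and balanced: "sum (lam (10 * mixing_block j)) UNIV \<le> 9 * lam (10 * mixing_block j) C" for j a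
  proof -
    define f where "f r = lam (10 * mixing_block j + r)" for r
    have "\<forall>r<10. f r = (f (Suc r))(arrow_winner (full_loop ! r) :=
      f (Suc r) (arrow_winner (full_loop ! r)) + f (Suc r) (arrow_loser (full_loop ! r)))"
    proof (intro allI impI)
      fix r :: nat assume "r < 10"
      then have "arrows (10 * mixing_block j + r) = full_loop ! r"
        using arrows_block[of r "mixing_block j"] by (simp add: loop_def)
      then show "f r = (f (Suc r))(arrow_winner (full_loop ! r) :=
          f (Suc r) (arrow_winner (full_loop ! r)) + f (Suc r) (arrow_loser (full_loop ! r)))"
        using step[of "10 * mixing_block j + r"] by (simp add: f_def)
    qed
    note f = full_loop_lengths[of f, OF this]
    have pos: "0 \<le> f 10 A" "0 \<le> f 10 B" "0 \<le> f 10 C" "0 \<le> f 10 D"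
      by (simp_all add: f_def nonneg)
    have "\<forall>a. sum (f 10) UNIV \<le> f 0 a"
      unfolding all_letters sum_letters f using pos by simp
    then show "sum (lam (10 * mixing_block j + 10)) UNIV \<le> lam (10 * mixing_block j) a"
      by (simp add: f_def)
    \<comment> \<open>In the sum the coefficients of \<open>f 10 A\<close>, \<open>f 10 B\<close>,
      \<open>f 10 C\<close>, \<open>f 10 D\<close> are 7, 5, 9, 6, and in \<open>f 0 C\<close> each
      is at least 1; hence the factor 9.\<close>
    have "sum (f 0) UNIV \<le> 9 * f 0 C"
      unfolding sum_letters f using pos by simp
    then show "sum (lam (10 * mixing_block j)) UNIV \<le> 9 * lam (10 * mixing_block j) C"
      by (simp add: f_def)
  qed

  \<comment> \<open>Vanishing lengths at level \<open>Suc n\<close> would make those at level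
    \<open>n\<close> vanish, as earlier lengths are sums of later ones.\<close>
  have sum_pos: "0 < sum (lam n) UNIV" for n
  proof (induction n)
    case (Suc n)
    show ?case
    proof (rule ccontr)
      assume "\<not> 0 < sum (lam (Suc n)) UNIV"
      moreover have "0 \<le> sum (lam (Suc n)) UNIV" by (intro sum_nonneg nonneg)
      ultimately have "sum (lam (Suc n)) UNIV = 0" by simp
      then have "lam (Suc n) a = 0" for a
        using sum_nonneg_eq_0_iff[of UNIV "lam (Suc n)"] nonneg by simp
      then have "lam n a = 0" for a by (subst step) simp
      with Suc show False by simp
    qed
  qed (simp add: total)
  \<comment> \<open>A full loop starts at \<open>10 * mixing_block n\<close>, not before
    \<open>n\<close>; at its start each letter has at least the positive total length left after
    it.\<close>
  have pos: "0 < lam n a" for n a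
  proof -
    have "0 < sum (lam (10 * mixing_block n + 10)) UNIV" by (rule sum_pos)
    also have "\<dots> \<le> lam (10 * mixing_block n) a" by (rule mix)
    also have "\<dots> \<le> lam n a" using mixing_block_ge[of n] by (intro anti) simp
    finally show ?thesis .
  qed

  \<comment> \<open>The arrow at offset 3 subtracts the length of \<open>C\<close> from
    \<open>B\<close>; the other arrows increase nothing.\<close>
  have partial: "lam (10 * i + 10) B + lam (10 * i + 10) C \<le> lam (10 * i) B"
    if "i \<notin> range mixing_block" for i
  proof -
    have "arrows (10 * i + 3) = ([A, B, D, C], [D, A, C, B], B, C)"
      using arrows_block[of 3 i] that by (simp add: loop_def partial_loop_def)
    then have "lam (10 * i + 3) B = lam (10 * i + 4) B + lam (10 * i + 4) C"
      using step[of "10 * i + 3"] by (simp add: add.commute[of 4])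
    moreover have "lam (10 * i + 3) B \<le> lam (10 * i) B" by (rule anti) simp
    moreover have "lam (10 * i + 10) B \<le> lam (10 * i + 4) B" "lam (10 * i + 10) C \<le> lam (10 * i + 4) C"
      by (rule anti, simp)+
    ultimately show ?thesis by linarith
  qed
  \<comment> \<open>Each of the \<open>k\<close> partial loops costs \<open>B\<close> at least the
    final length of \<open>C\<close>, since that length never increases. So \<open>C\<close> is
    short after a long run.\<close>
  have run: "lam (10 * (mixing_block j + 1 + k)) B + real k * lam (10 * (mixing_block j + 1 + k)) C
      \<le> lam (10 * (mixing_block j + 1)) B"
    if "mixing_block j + 1 + k \<le> mixing_block (Suc j)" for j k
    using that
  proof (induction k)
    case (Suc k)
    define i where "i = mixing_block j + 1 + k"
    have Suc_i: "10 * (mixing_block j + 1 + Suc k) = 10 * i + 10" by (simp add: i_def)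
    have "i \<notin> range mixing_block"
      using Suc.prems by (intro mixing_block_gap[of j]) (simp_all add: i_def)
    then have "lam (10 * i + 10) B + lam (10 * i + 10) C \<le> lam (10 * i) B" by (rule partial)
    moreover have "real k * lam (10 * i + 10) C \<le> real k * lam (10 * i) C"
      by (intro mult_left_mono anti) simp_all
    moreover have "lam (10 * i) B + real k * lam (10 * i) C \<le> lam (10 * (mixing_block j + 1)) B"
      using Suc.IH Suc.prems unfolding i_def by linarith
    ultimately show ?case unfolding Suc_i by (simp add: algebra_simps)
  qed simp
  \<comment> \<open>The run of \<open>9 * 4 ^ s\<close> loops ends where the next full loop begins,
    so \<open>balanced\<close> passes from \<open>C\<close> to the total length and uses up the
    factor 9.\<close>
  have short: "4 ^ (10 * (mixing_block j + 1)) * sum (lam (10 * mixing_block (Suc j))) UNIV \<le> 1" for j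
  proof -
    define s where "s = 10 * (mixing_block j + 1)"
    define n where "n = 10 * mixing_block (Suc j)"
    have n: "10 * (mixing_block j + 1 + 9 * 4 ^ s) = n" by (simp add: n_def s_def)
    have "lam n B + real (9 * 4 ^ s) * lam n C \<le> lam s B"
      using run[of j "9 * 4 ^ s"] unfolding n by (simp add: s_def)
    then have "4 ^ s * (9 * lam n C) \<le> 1"
      using le_1[of s B] nonneg[of n B] by simp
    moreover have "4 ^ s * sum (lam n) UNIV \<le> 4 ^ s * (9 * lam n C)"
      unfolding n_def by (intro mult_left_mono balanced) simp
    ultimately show ?thesis unfolding s_def n_def by linarith
  qed

  interpret rauzy_path "\<lambda>n. position (top_row (arrows n))" "\<lambda>n. position (bot_row (arrows n))"
    "\<lambda>n. winner_seq n" "\<lambda>n. loser_seq n" lam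
  proof
    fix n
    note rows = loop_rows[OF arrows_in_loop[of n]]
    show "bij_betw (position (top_row (arrows n))) UNIV {1..CARD('a)}"
      using bij_betw_position[OF rows(1)] rows(2,3) card_letters by simp
    show "bij_betw (position (bot_row (arrows n))) UNIV {1..CARD('a)}"
      using bij_betw_position[OF rows(4)] rows(5,6) card_letters by simp
    show "rauzy_arrow (position (top_row (arrows n))) (position (bot_row (arrows n)))
        (winner_seq n) (loser_seq n)
        (position (top_row (arrows (Suc n)))) (position (bot_row (arrows (Suc n))))"
      using consecutive_arrows[of n] by (simp add: consecutive_def)
  qed (rule pos, rule step)

  \<comment> \<open>Between \<open>s\<close> and \<open>n\<close> the letter \<open>A\<close> never
    loses, so its height at \<open>n\<close> is still at most \<open>2 ^ s\<close>, whose square is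
    the factor in \<open>short\<close>.\<close>
  have early: "\<exists>n a. total_length (iet_at n) < \<epsilon> \<and>
      (real (height n a))\<^sup>2 * total_length (iet_at n) \<le> 1" if "\<epsilon> > 0" for \<epsilon> :: real
  proof -
    obtain j where j: "1 / \<epsilon> < 4 ^ j"
      using real_arch_pow[of 4 "1 / \<epsilon>"] by auto
    define s where "s = 10 * (mixing_block j + 1)"
    define n where "n = 10 * mixing_block (Suc j)"
    have short': "4 ^ s * total_length (iet_at n) \<le> 1"
      using short[of j] by (simp only: total_length_at s_def n_def)
    have "(4::real) ^ j \<le> 4 ^ s"
      using mixing_block_ge[of j] by (intro power_increasing) (simp_all add: s_def)
    with j have "1 / \<epsilon> < 4 ^ s" by linarith
    then have "1 < 4 ^ s * \<epsilon>" using \<open>\<epsilon> > 0\<close> by (simp add: divide_less_eq)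
    with short' have "4 ^ s * total_length (iet_at n) < 4 ^ s * \<epsilon>" by linarith
    then have small: "total_length (iet_at n) < \<epsilon>" by simp
    have "height n A = height s A"
    proof (rule height_const)
      show "s \<le> n" by (simp add: s_def n_def)
      fix i assume i: "s \<le> i" "i < n"
      have "mixing_block j + 1 \<le> i div 10"
        using div_le_mono[OF i(1), of 10] by (simp only: s_def) simp
      moreover have "i div 10 < mixing_block (Suc j)"
        using i(2) unfolding n_def by (intro less_mult_imp_div_less) (simp only: mult.commute)
      ultimately have "i div 10 \<notin> range mixing_block"
        by (intro mixing_block_gap[of j]) simp_all
      then have "arrows i \<in> set partial_loop" using arrows_in_loop[of i] by (simp add: loop_def)
      then show "loser_seq i \<noteq> A" by (auto simp: partial_loop_def neqs)
    qed
    then have "real (height n A) \<le> 2 ^ s" using height_le[of s A]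
      by (metis of_nat_le_iff of_nat_numeral of_nat_power)
    then have "(real (height n A))\<^sup>2 \<le> (2 ^ s)\<^sup>2" by (intro power_mono) simp_all
    also have "((2::real) ^ s)\<^sup>2 = 4 ^ s" by (simp add: power2_eq_square power_mult_distrib[symmetric])
    finally have "(real (height n A))\<^sup>2 * total_length (iet_at n) \<le> 4 ^ s * total_length (iet_at n)"
      using total_length_at_pos[of n] by (intro mult_right_mono) simp_all
    with small short' show ?thesis by (intro exI[of _ n] exI[of _ A]) linarith
  qed

  have arrows_0: "arrows 0 = ([A, B, C, D], [D, A, C, B], B, D)"
    by (simp add: arrows_def loop_def full_loop_def partial_loop_def)
  have "admissible (iet_at 0)"
    unfolding admissible_def
  proof (intro allI impI)
    fix k assume k: "1 \<le> k \<and> k \<le> CARD('a) - 1"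
    \<comment> \<open>\<open>D\<close> is first in the bottom row and fourth in the top row, while
      \<open>k\<close> is at most 3.\<close>
    have "D \<in> bot_pos (iet_at 0) -` {1..k}" "D \<notin> top_pos (iet_at 0) -` {1..k}"
      using k by (simp_all add: iet_at_def arrows_0 card_letters neqs)
    then show "top_pos (iet_at 0) -` {1..k} \<noteq> bot_pos (iet_at 0) -` {1..k}" by blast
  qed
  moreover have "condition_Z (iet_at 0)"
  proof (rule condition_Z_if_winners_change[where L = 12])
    fix n :: nat
    \<comment> \<open>The next block starts at most 10 steps after \<open>n\<close>, and either loop
      begins with the winners \<open>B\<close>, \<open>C\<close>; a window of 12 steps contains
      both.\<close>
    define i where "i = n div 10 + 1"
    have "winner_seq (10 * i + 0) = B" "winner_seq (10 * i + 1) = C"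
      by (subst arrows_block; simp add: loop_def full_loop_def partial_loop_def)+
    then have "winner (rv_iter (iet_at 0) (10 * i)) \<noteq> winner (rv_iter (iet_at 0) (10 * i + 1))"
      unfolding rv_iter_at winner_at using neqs by simp
    moreover have "n \<le> 10 * i" "10 * i + 1 < n + 12" unfolding i_def by presburger+
    ultimately show "\<exists>i\<in>{n..<n + 12}. \<exists>j\<in>{n..<n + 12}.
        winner (rv_iter (iet_at 0) i) \<noteq> winner (rv_iter (iet_at 0) j)"
      by (intro bexI[of _ "10 * i"] bexI[of _ "10 * i + 1"]) simp_all
  qed
  moreover have "keane (iet_at 0)"
  proof (rule keane_at_0)
    fix \<epsilon> :: real assume "\<epsilon> > 0"
    from early[OF this] show "\<exists>n. total_length (iet_at n) < \<epsilon>" by (elim exE conjE) (rule exI)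
  qed
  moreover have "\<not> condition_U (iet_at 0)" by (rule not_condition_U_at_0) (rule early)
  moreover have "total_length (iet_at 0) = 1" by (simp add: total_length_at total)
  ultimately show ?thesis using iet_data_at[of 0] by (intro exI[of _ "iet_at 0"] conjI) assumption+
qed

end

theorem mainTheorem7:
  "\<exists>T :: 4 iet. iet_data T \<and> admissible T \<and> keane T \<and> total_length T = 1 \<and>
     condition_Z T \<and> \<not> condition_U T"
proof -
  \<comment> \<open>In the type \<open>4\<close> the numeral 4 denotes 0, so these are four distinct
    elements.\<close>
  interpret four_letters "1 :: 4" 2 3 4
  proof
    show "distinct [1 :: 4, 2, 3, 4]" by simp
    show "UNIV = {1 :: 4, 2, 3, 4}" by (rule UNIV_4)
  qed
  show ?thesis by (rule ex_condition_Z_not_U)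
qed

end
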